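(* Let $m\ge 2$. If $\mathcal{D}\tau \in \Omega_m$ and $\Omega_m$ is invariant under $\mathcal{L}_f$ and $\mathcal{L}_{g/L^1_g}$, then $\Omega_{m+p}=\Omega_m$ for all $p\ge 0$.
   Context: Setting: $f,g$ are smooth vector fields and $h$ a smooth scalar function on an open set $M\subset\mathbb{R}^n$ (they define the system $\dot x=f(x)u+g(x)w$, $y=h(x)$, with known scalar input $u$ and unknown scalar input $w$). $\mathcal{L}_\theta h=\frac{\partial h}{\partial x}\theta$ is the Lie derivative, $[a,b]=\frac{\partial b}{\partial x}a-\frac{\partial a}{\partial x}b$ the Lie bracket, $\mathcal{D}$ the differential with respect to $x$. Put $L^1_g\triangleq\mathcal{L}_gh$, $L^2_g\triangleq\mathcal{L}^2_gh=\mathcal{L}_g\mathcal{L}_gh$. Standing assumption: $L^1_g\neq0$ everywhere on the region considered. Define $$\tau\triangleq\frac{L^2_g}{(L^1_g)^2}.$$ Codistributions are spans (with smooth function coefficients) of covector fields. For a codistribution $\Omega$, $\mathcal{L}_\theta\Omega$ is the codistribution spanned by the Lie derivatives along $\theta$ of the covectors of $\Omega$ (with $\mathcal{L}_\theta\mathcal{D}\lambda=\mathcal{D}\mathcal{L}_\theta\lambda$); $\Omega$ is invariant under $\mathcal{L}_\theta$ if $\mathcal{L}_\theta\Omega\subseteq\Omega$. Sums of codistributions are spans of all generators. Set $\phi_0=f$, $\phi_m=\frac{[\phi_{m-1},g]}{L^1_g}$. The codistributions $\Omega_m$ are defined by $\Omega_0=\mathrm{span}\{\mathcal{D}h\}$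 and, for $m\ge1$, $\Omega_m=\Omega_{m-1}+\mathcal{L}_{f}\Omega_{m-1}+\mathcal{L}_{g/L^1_g}\Omega_{m-1}+\mathrm{span}\{\mathcal{L}_{\phi_{m-1}}\mathcal{D}h\}$. *)

theory Defs
  imports "HOL-Analysis.Analysis"
begin

text \<open>
  Points and vectors of \<open>\<real>\<^sup>n\<close> have type \<open>real ^ 'n\<close>.  A covector field is given by its row of
  components, so it has type \<open>real ^ 'n \<Rightarrow> real ^ 'n\<close> as well; the pairing of a covector with a
  vector is the inner product.  Fields are total functions, but only their values on the
  open set \<open>M\<close> matter.
\<close>

primrec k_smooth_on :: "nat \<Rightarrow> 'a::real_normed_vector set \<Rightarrow> ('a \<Rightarrow> 'b::real_normed_vector) \<Rightarrow> bool"
where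
  "k_smooth_on 0 S F \<longleftrightarrow> continuous_on S F"
| "k_smooth_on (Suc k) S F \<longleftrightarrow>
     (\<forall>x\<in>S. F differentiable (at x)) \<and>
     (\<forall>v. k_smooth_on k S (\<lambda>x. frechet_derivative F (at x) v))"

text \<open>
  This is \<open>C\<^sup>\<infinity>\<close> for open \<open>S\<close> in a finite-dimensional space, which is how it is used here.
\<close>

definition smooth_on :: "'a::real_normed_vector set \<Rightarrow> ('a \<Rightarrow> 'b::real_normed_vector) \<Rightarrow> bool"
  where "smooth_on S F \<longleftrightarrow> (\<forall>k. k_smooth_on k S F)"

definition lie_deriv :: "(real ^ 'n \<Rightarrow> real ^ 'n) \<Rightarrow> (real ^ 'n \<Rightarrow> real) \<Rightarrow> real ^ 'n \<Rightarrow> real"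
  where "lie_deriv \<theta> F = (\<lambda>x. frechet_derivative F (at x) (\<theta> x))"

definition lie_bracket ::
    "(real ^ 'n \<Rightarrow> real ^ 'n) \<Rightarrow> (real ^ 'n \<Rightarrow> real ^ 'n) \<Rightarrow> real ^ 'n \<Rightarrow> real ^ 'n"
  where "lie_bracket a b =
    (\<lambda>x. frechet_derivative b (at x) (a x) - frechet_derivative a (at x) (b x))"

definition differential :: "(real ^ 'n \<Rightarrow> real) \<Rightarrow> real ^ 'n \<Rightarrow> real ^ 'n"
  where "differential F = (\<lambda>x. \<chi> i. frechet_derivative F (at x) (axis i 1))"

text \<open>
  The Lie derivative of a row covector field,
  \<open>L\<^sub>\<theta> \<omega> = \<theta>\<^sup>T (\<partial>\<omega>\<^sup>T/\<partial>x)\<^sup>T + \<omega> (\<partial>\<theta>/\<partial>x)\<close>; on differentials of smooth functions it is \<open>D (L\<^sub>\<theta> \<lambda>)\<close>.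
\<close>

definition lie_deriv_covec ::
    "(real ^ 'n \<Rightarrow> real ^ 'n) \<Rightarrow> (real ^ 'n \<Rightarrow> real ^ 'n) \<Rightarrow> real ^ 'n \<Rightarrow> real ^ 'n"
  where "lie_deriv_covec \<theta> \<omega> =
    (\<lambda>x. frechet_derivative \<omega> (at x) (\<theta> x) + \<omega> x v* matrix (frechet_derivative \<theta> (at x)))"

text \<open>
  Codistributions on \<open>M\<close> are spans over the smooth functions on \<open>M\<close>.  The span is closed under
  changing a covector field outside \<open>M\<close>, so equality of codistributions on \<open>M\<close> is set equality.
\<close>

definition codist_span ::
    "(real ^ 'n) set \<Rightarrow> (real ^ 'n \<Rightarrow> real ^ 'n) set \<Rightarrow> (real ^ 'n \<Rightarrow> real ^ 'n) set"
  where "codist_span M S =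
    {\<omega>. \<exists>B c. finite B \<and> B \<subseteq> S \<and> (\<forall>\<eta>\<in>B. smooth_on M (c \<eta> :: real ^ 'n \<Rightarrow> real)) \<and>
              (\<forall>x\<in>M. \<omega> x = (\<Sum>\<eta>\<in>B. c \<eta> x *\<^sub>R \<eta> x))}"

definition lie_codist ::
    "(real ^ 'n) set \<Rightarrow> (real ^ 'n \<Rightarrow> real ^ 'n) \<Rightarrow> (real ^ 'n \<Rightarrow> real ^ 'n) set \<Rightarrow>
     (real ^ 'n \<Rightarrow> real ^ 'n) set"
  where "lie_codist M \<theta> \<Omega> = codist_span M (lie_deriv_covec \<theta> ` \<Omega>)"

definition codist_invariant ::
    "(real ^ 'n) set \<Rightarrow> (real ^ 'n \<Rightarrow> real ^ 'n) \<Rightarrow> (real ^ 'n \<Rightarrow> real ^ 'n) set \<Rightarrow> bool"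
  where "codist_invariant M \<theta> \<Omega> \<longleftrightarrow> lie_codist M \<theta> \<Omega> \<subseteq> \<Omega>"

definition tau :: "(real ^ 'n \<Rightarrow> real ^ 'n) \<Rightarrow> (real ^ 'n \<Rightarrow> real) \<Rightarrow> real ^ 'n \<Rightarrow> real"
  where "tau g h = (\<lambda>x. lie_deriv g (lie_deriv g h) x / (lie_deriv g h x)\<^sup>2)"

definition g_normalized ::
    "(real ^ 'n \<Rightarrow> real ^ 'n) \<Rightarrow> (real ^ 'n \<Rightarrow> real) \<Rightarrow> real ^ 'n \<Rightarrow> real ^ 'n"
  where "g_normalized g h = (\<lambda>x. g x /\<^sub>R lie_deriv g h x)"

primrec phi ::
    "(real ^ 'n \<Rightarrow> real ^ 'n) \<Rightarrow> (real ^ 'n \<Rightarrow> real ^ 'n) \<Rightarrow> (real ^ 'n \<Rightarrow> real) \<Rightarrow> nat \<Rightarrow>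
     real ^ 'n \<Rightarrow> real ^ 'n"
where
  "phi f g h 0 = f"
| "phi f g h (Suc m) = (\<lambda>x. lie_bracket (phi f g h m) g x /\<^sub>R lie_deriv g h x)"

primrec Omega ::
    "(real ^ 'n) set \<Rightarrow> (real ^ 'n \<Rightarrow> real ^ 'n) \<Rightarrow> (real ^ 'n \<Rightarrow> real ^ 'n) \<Rightarrow>
     (real ^ 'n \<Rightarrow> real) \<Rightarrow> nat \<Rightarrow> (real ^ 'n \<Rightarrow> real ^ 'n) set"
where
  "Omega M f g h 0 = codist_span M {differential h}"
| "Omega M f g h (Suc m) =
     codist_span M
       (Omega M f g h m \<union>
        lie_codist M f (Omega M f g h m) \<union>
        lie_codist M (g_normalized g h) (Omega M f g h m) \<union>
        codist_span M {lie_deriv_covec (phi f g h m) (differential h)})"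

end

theory Submission
  imports Defs
begin

text \<open>
  Write \<open>L = L\<^sub>g h\<close>, \<open>G = g/L\<close> and \<open>\<mu>\<^sub>k = L\<^bsub>\<phi>\<^sub>k\<^esub> L / L\<close>.  Since \<open>L\<^sub>G h = 1\<close> and \<open>L\<^sub>G L = L \<tau>\<close>, one finds
  \<open>\<phi>\<^bsub>k+1\<^esub> = [\<phi>\<^sub>k, G] + \<mu>\<^sub>k G\<close>, and applying both sides to \<open>h\<close> and to \<open>L\<close> gives
  \<open>\<mu>\<^sub>k = L\<^bsub>\<phi>\<^bsub>k+1\<^esub>\<^esub> h + L\<^sub>G L\<^bsub>\<phi>\<^sub>k\<^esub> h\<close> and \<open>\<mu>\<^bsub>k+1\<^esub> = L\<^bsub>\<phi>\<^sub>k\<^esub> \<tau> - L\<^sub>G \<mu>\<^sub>k + \<tau> \<mu>\<^sub>k\<close>.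
  Hence, by induction on \<open>k\<close>, \<open>\<Omega>\<^sub>m\<close> is invariant under the Lie derivative along \<open>\<phi>\<^sub>k\<close> and contains the
  differentials of \<open>L\<^bsub>\<phi>\<^sub>k\<^esub> h\<close> and \<open>L\<^bsub>\<phi>\<^bsub>k+1\<^esub>\<^esub> h\<close>: the latter two put \<open>D\<mu>\<^sub>k\<close> in \<open>\<Omega>\<^sub>m\<close>, the formula for \<open>\<phi>\<^bsub>k+1\<^esub>\<close>
  then carries the invariance over, and the recursion for \<open>\<mu>\<^bsub>k+1\<^esub>\<close> yields the next differential.
  The base case \<open>k = 0\<close> is where \<open>m \<ge> 2\<close> is used.
\<close>

subsection \<open>Directional derivatives and smooth functions\<close>

text \<open>With the direction as first argument, \<open>dir_deriv v F\<close> has the same type as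
  \<open>F\<close>, so derivatives can be iterated without passing to spaces of linear maps.\<close>

definition dir_deriv :: "'a::real_normed_vector \<Rightarrow> ('a \<Rightarrow> 'b::real_normed_vector) \<Rightarrow> 'a \<Rightarrow> 'b"
  where "dir_deriv v F = (\<lambda>x. frechet_derivative F (at x) v)"

lemma dir_deriv_eqI:
  assumes "(F has_derivative F') (at x)"
  shows "dir_deriv v F x = F' v"
  using frechet_derivative_at[OF assms] by (simp add: dir_deriv_def)

lemma has_derivative_dir_deriv:
  assumes "F differentiable (at x)"
  shows "(F has_derivative (\<lambda>v. dir_deriv v F x)) (at x)"
  using assms by (simp add: dir_deriv_def frechet_derivative_works[symmetric])

text \<open>Functions agreeing on a neighbourhood of \<open>x\<close> have the same derivatives
  there, and \<open>frechet_derivative\<close> chooses among these; hence the equality holds even at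
  points where no derivative exists.\<close>

lemma dir_deriv_cong:
  assumes "open M" "x \<in> M" "\<And>y. y \<in> M \<Longrightarrow> F y = G y"
  shows "dir_deriv v F x = dir_deriv v G x"
proof -
  have "(F has_derivative D) (at x) \<longleftrightarrow> (G has_derivative D) (at x)" for D
  proof
    assume "(F has_derivative D) (at x)"
    then show "(G has_derivative D) (at x)"
      using assms by (rule has_derivative_transform_within_open)
  next
    assume "(G has_derivative D) (at x)"
    then show "(F has_derivative D) (at x)"
      using assms(1,2) by (rule has_derivative_transform_within_open) (simp add: assms(3))
  qed
  then show ?thesis
    by (simp add: dir_deriv_def frechet_derivative_def)
qed

section \<open>Smoothness of finite order\<close>

lemma k_smooth_Suc:
  "k_smooth_on (Suc k) M F \<longleftrightarrow>
    (\<forall>x\<in>M. F differentiable (at x)) \<and> (\<forall>v. k_smooth_on k M (dir_deriv v F))"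
  by (simp add: dir_deriv_def)

declare k_smooth_on.simps(2) [simp del]

lemma differentiable_cong_open:
  assumes "open M" "x \<in> M" "\<And>y. y \<in> M \<Longrightarrow> F y = G y" "F differentiable (at x)"
  shows "G differentiable (at x)"
proof -
  obtain D where "(F has_derivative D) (at x)"
    using assms(4) by (auto simp: differentiable_def)
  then have "(G has_derivative D) (at x)"
    using assms(1-3) by (rule has_derivative_transform_within_open)
  then show ?thesis by (rule differentiableI)
qed

lemma k_smooth_cong:
  assumes "open M"
  shows "k_smooth_on k M F \<Longrightarrow> (\<And>x. x \<in> M \<Longrightarrow> F x = G x) \<Longrightarrow> k_smooth_on k M G"
proof (induction k arbitrary: F G)
  case 0
  then show ?case using continuous_on_cong[of M M F G] by simp
next
  case (Suc k)
  have "k_smooth_on k M (dir_deriv v G)" for v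
  proof (rule Suc.IH[of "dir_deriv v F"])
    show "k_smooth_on k M (dir_deriv v F)"
      using Suc.prems(1) by (simp add: k_smooth_Suc)
    show "dir_deriv v F x = dir_deriv v G x" if "x \<in> M" for x
      using assms that Suc.prems(2) by (rule dir_deriv_cong)
  qed
  moreover have "G differentiable (at x)" if "x \<in> M" for x
  proof (rule differentiable_cong_open[OF assms that Suc.prems(2)])
    show "F differentiable (at x)" using Suc.prems(1) that by (simp add: k_smooth_Suc)
  qed
  ultimately show ?case by (simp add: k_smooth_Suc)
qed

text \<open>Serves the product rule, where one factor stays undifferentiated and must be available
  at the lower order.\<close>

lemma k_smooth_SucD: "k_smooth_on (Suc k) M F \<Longrightarrow> k_smooth_on k M F"
proof (induction k arbitrary: F)
  case 0
  then show ?case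
    by (auto simp: k_smooth_Suc intro!: differentiable_imp_continuous_on
        simp: differentiable_on_def differentiable_at_withinI)
next
  case (Suc k)
  then show ?case by (subst k_smooth_Suc) (auto simp: k_smooth_Suc[of "Suc k"])
qed

lemma k_smooth_add:
  assumes "open M"
  shows "k_smooth_on k M F \<Longrightarrow> k_smooth_on k M G \<Longrightarrow> k_smooth_on k M (\<lambda>x. F x + G x)"
proof (induction k arbitrary: F G)
  case 0
  then show ?case by (simp add: continuous_on_add)
next
  case (Suc k)
  have "k_smooth_on k M (dir_deriv v (\<lambda>x. F x + G x))" for v
  proof (rule k_smooth_cong[OF assms])
    show "k_smooth_on k M (\<lambda>x. dir_deriv v F x + dir_deriv v G x)"
      using Suc by (auto simp: k_smooth_Suc)
    show "dir_deriv v F x + dir_deriv v G x = dir_deriv v (\<lambda>x. F x + G x) x" if "x \<in> M" for x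
      using Suc.prems that
      by (intro dir_deriv_eqI[symmetric] has_derivative_add has_derivative_dir_deriv)
         (auto simp: k_smooth_Suc)
  qed
  then show ?case using Suc.prems by (simp add: k_smooth_Suc)
qed

text \<open>The Leibniz rule turns the derivative into a sum of two products of the same shape, to
  which the induction hypothesis applies. One induction covers scaling, inner products and
  multiplication.\<close>

lemma k_smooth_bilinear:
  assumes "open M" "bounded_bilinear B"
  shows "k_smooth_on k M F \<Longrightarrow> k_smooth_on k M G \<Longrightarrow> k_smooth_on k M (\<lambda>x. B (F x) (G x))"
proof (induction k arbitrary: F G)
  case 0
  then show ?case by (simp add: bounded_bilinear.continuous_on[OF assms(2)])
next
  case (Suc k)
  have D: "((\<lambda>x. B (F x) (G x)) has_derivative
      (\<lambda>v. B (F x) (dir_deriv v G x) + B (dir_deriv v F x) (G x))) (at x)" if "x \<in> M" for x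
    using Suc.prems that
    by (intro bounded_bilinear.FDERIV[OF assms(2)] has_derivative_dir_deriv)
       (auto simp: k_smooth_Suc)
  have "k_smooth_on k M (dir_deriv v (\<lambda>x. B (F x) (G x)))" for v
  proof (rule k_smooth_cong[OF assms(1)])
    show "k_smooth_on k M (\<lambda>x. B (F x) (dir_deriv v G x) + B (dir_deriv v F x) (G x))"
      using Suc.prems[THEN k_smooth_SucD] Suc.prems
      by (intro k_smooth_add assms Suc.IH) (auto simp: k_smooth_Suc)
  qed (simp add: dir_deriv_eqI[OF D])
  moreover have "(\<lambda>x. B (F x) (G x)) differentiable (at x)" if "x \<in> M" for x
    using D[OF that] by (rule differentiableI)
  ultimately show ?case by (simp add: k_smooth_Suc)
qed

lemma dir_deriv_const [simp]: "dir_deriv v (\<lambda>x. c) = (\<lambda>x. 0)"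
  by (simp add: dir_deriv_def)

lemma k_smooth_const: "k_smooth_on k M (\<lambda>x. c)"
  by (induction k arbitrary: c) (simp_all add: k_smooth_Suc)

section \<open>Smoothness of all orders and its closure properties\<close>

lemma smooth_cong:
  "smooth_on M F \<Longrightarrow> open M \<Longrightarrow> (\<And>x. x \<in> M \<Longrightarrow> F x = G x) \<Longrightarrow> smooth_on M G"
  unfolding smooth_on_def using k_smooth_cong by blast

lemma smooth_differentiable: "smooth_on M F \<Longrightarrow> x \<in> M \<Longrightarrow> F differentiable (at x)"
  unfolding smooth_on_def by (metis k_smooth_Suc)

lemma smooth_has_derivative:
  "smooth_on M F \<Longrightarrow> x \<in> M \<Longrightarrow> (F has_derivative (\<lambda>v. dir_deriv v F x)) (at x)"
  by (intro has_derivative_dir_deriv smooth_differentiable)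

named_theorems smooth_intros

lemma smooth_dir_deriv [smooth_intros]: "smooth_on M F \<Longrightarrow> smooth_on M (dir_deriv v F)"
  unfolding smooth_on_def by (metis k_smooth_Suc)

lemma smooth_const [smooth_intros]: "smooth_on M (\<lambda>x. c)"
  by (simp add: smooth_on_def k_smooth_const)

lemma smooth_add [smooth_intros]:
  "open M \<Longrightarrow> smooth_on M F \<Longrightarrow> smooth_on M G \<Longrightarrow> smooth_on M (\<lambda>x. F x + G x)"
  by (simp add: smooth_on_def k_smooth_add)

lemma smooth_bilinear:
  "bounded_bilinear B \<Longrightarrow> open M \<Longrightarrow> smooth_on M F \<Longrightarrow> smooth_on M G \<Longrightarrow>
    smooth_on M (\<lambda>x. B (F x) (G x))"
  by (simp add: smooth_on_def k_smooth_bilinear)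

lemmas smooth_scaleR [smooth_intros] = smooth_bilinear[OF bounded_bilinear_scaleR]
lemmas smooth_inner [smooth_intros] = smooth_bilinear[OF bounded_bilinear_inner]
lemmas smooth_mult [smooth_intros] = smooth_bilinear[OF bounded_bilinear_mult]

lemma smooth_minus [smooth_intros]:
  assumes "open M" "smooth_on M F" shows "smooth_on M (\<lambda>x. - F x)"
  using smooth_scaleR[OF assms(1) smooth_const assms(2), of "-1"] by simp

lemma smooth_diff [smooth_intros]:
  assumes "open M" "smooth_on M F" "smooth_on M G" shows "smooth_on M (\<lambda>x. F x - G x)"
  using smooth_add[OF assms(1,2) smooth_minus[OF assms(1,3)]] by simp

lemma smooth_sum [smooth_intros]:
  assumes "open M" "\<And>i. i \<in> I \<Longrightarrow> smooth_on M (F i)"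
  shows "smooth_on M (\<lambda>x. \<Sum>i\<in>I. F i x)"
  using assms(2)
  by (induction I rule: infinite_finite_induct) (auto intro!: smooth_intros assms(1))

lemma smooth_power [smooth_intros]:
  fixes F :: "'a::real_normed_vector \<Rightarrow> 'b::real_normed_algebra_1"
  assumes "open M" "smooth_on M F"
  shows "smooth_on M (\<lambda>x. F x ^ n)"
  by (induction n) (auto intro!: smooth_intros assms)

text \<open>The derivative of \<open>inverse (F x)\<close> is a product of the same inverse and a
  derivative of \<open>F\<close>. With \<open>F\<close> smooth to all orders, only the order of the
  inverse has to go down, so \<open>F\<close> stays fixed in the induction.\<close>

lemma k_smooth_inverse:
  fixes F :: "'a::real_normed_vector \<Rightarrow> real"
  assumes "open M" "smooth_on M F" "\<forall>x\<in>M. F x \<noteq> 0"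
  shows "k_smooth_on k M (\<lambda>x. inverse (F x))"
proof (induction k)
  case 0
  have "continuous_on M F" using assms(2) by (metis k_smooth_on.simps(1) smooth_on_def)
  then show ?case using assms(3) by (simp add: continuous_on_inverse)
next
  case (Suc k)
  have D: "((\<lambda>x. inverse (F x)) has_derivative
      (\<lambda>v. - (inverse (F x) * dir_deriv v F x * inverse (F x)))) (at x)" if "x \<in> M" for x
    using that assms by (intro Deriv.has_derivative_inverse smooth_has_derivative) auto
  have "k_smooth_on k M (dir_deriv v (\<lambda>x. inverse (F x)))" for v
  proof (rule k_smooth_cong[OF assms(1)])
    have "k_smooth_on k M (dir_deriv v F)"
      using smooth_dir_deriv[OF assms(2)] by (simp add: smooth_on_def)
    then show "k_smooth_on k M (\<lambda>x. (- 1) * (inverse (F x) * dir_deriv v F x * inverse (F x)))"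
      by (intro k_smooth_bilinear[OF assms(1) bounded_bilinear_mult] k_smooth_const Suc)
  qed (simp add: dir_deriv_eqI[OF D])
  moreover have "(\<lambda>x. inverse (F x)) differentiable (at x)" if "x \<in> M" for x
    using D[OF that] by (rule differentiableI)
  ultimately show ?case by (simp add: k_smooth_Suc)
qed

lemma smooth_inverse [smooth_intros]:
  fixes F :: "'a::real_normed_vector \<Rightarrow> real"
  shows "open M \<Longrightarrow> smooth_on M F \<Longrightarrow> \<forall>x\<in>M. F x \<noteq> 0 \<Longrightarrow> smooth_on M (\<lambda>x. inverse (F x))"
  by (simp add: k_smooth_inverse smooth_on_def)

lemma smooth_divide [smooth_intros]:
  fixes F :: "'a::real_normed_vector \<Rightarrow> real"
  shows "open M \<Longrightarrow> smooth_on M F \<Longrightarrow> smooth_on M G \<Longrightarrow> \<forall>x\<in>M. G x \<noteq> 0 \<Longrightarrow>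
    smooth_on M (\<lambda>x. F x / G x)"
  unfolding divide_inverse by (intro smooth_intros)

lemma smooth_componentwise:
  fixes F :: "'a::real_normed_vector \<Rightarrow> real ^ 'n"
  assumes "open M" "\<And>i. smooth_on M (\<lambda>x. F x $ i)"
  shows "smooth_on M F"
proof -
  have "smooth_on M (\<lambda>x. \<Sum>i\<in>UNIV. F x $ i *\<^sub>R (axis i 1 :: real ^ 'n))"
    by (intro smooth_intros assms)
  moreover have "(\<Sum>i\<in>UNIV. F x $ i *\<^sub>R axis i 1) = F x" for x
    using basis_expansion[of "F x"] by (simp add: scalar_mult_eq_scaleR)
  ultimately show ?thesis by simp
qed

lemma smooth_component [smooth_intros]:
  fixes F :: "'a::real_normed_vector \<Rightarrow> real ^ 'n"
  assumes "open M" "smooth_on M F"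
  shows "smooth_on M (\<lambda>x. F x $ i)"
  using smooth_inner[OF assms(1) smooth_const assms(2), of "axis i 1"]
  by (simp add: inner_axis')

section \<open>Calculus rules for directional derivatives\<close>

lemma dir_deriv_add:
  "smooth_on M F \<Longrightarrow> smooth_on M G \<Longrightarrow> x \<in> M \<Longrightarrow>
    dir_deriv v (\<lambda>x. F x + G x) x = dir_deriv v F x + dir_deriv v G x"
  by (intro dir_deriv_eqI has_derivative_add smooth_has_derivative)

lemma dir_deriv_diff:
  "smooth_on M F \<Longrightarrow> smooth_on M G \<Longrightarrow> x \<in> M \<Longrightarrow>
    dir_deriv v (\<lambda>x. F x - G x) x = dir_deriv v F x - dir_deriv v G x"
  by (intro dir_deriv_eqI has_derivative_diff smooth_has_derivative)

lemma dir_deriv_bilinear: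
  "bounded_bilinear B \<Longrightarrow> smooth_on M F \<Longrightarrow> smooth_on M G \<Longrightarrow> x \<in> M \<Longrightarrow>
    dir_deriv v (\<lambda>x. B (F x) (G x)) x = B (F x) (dir_deriv v G x) + B (dir_deriv v F x) (G x)"
  by (rule dir_deriv_eqI) (intro bounded_bilinear.FDERIV smooth_has_derivative)

lemmas dir_deriv_scaleR = dir_deriv_bilinear[OF bounded_bilinear_scaleR]
lemmas dir_deriv_inner = dir_deriv_bilinear[OF bounded_bilinear_inner]
lemmas dir_deriv_mult = dir_deriv_bilinear[OF bounded_bilinear_mult]

lemma dir_deriv_sum:
  "(\<And>i. i \<in> I \<Longrightarrow> smooth_on M (F i)) \<Longrightarrow> x \<in> M \<Longrightarrow>
    dir_deriv v (\<lambda>x. \<Sum>i\<in>I. F i x) x = (\<Sum>i\<in>I. dir_deriv v (F i) x)"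
  by (intro dir_deriv_eqI has_derivative_sum smooth_has_derivative)

lemma linear_dir_deriv: "smooth_on M F \<Longrightarrow> x \<in> M \<Longrightarrow> linear (\<lambda>v. dir_deriv v F x)"
  using smooth_has_derivative has_derivative_linear by blast

lemma dir_deriv_basis:
  fixes F :: "real ^ 'n \<Rightarrow> 'b::real_normed_vector"
  assumes "smooth_on M F" "x \<in> M"
  shows "dir_deriv v F x = (\<Sum>i\<in>UNIV. v $ i *\<^sub>R dir_deriv (axis i 1) F x)"
proof -
  interpret linear "\<lambda>v. dir_deriv v F x" by (rule linear_dir_deriv[OF assms])
  have "dir_deriv v F x = dir_deriv (\<Sum>i\<in>UNIV. v $ i *\<^sub>R axis i 1) F x"
    by (simp add: basis_expansion scalar_mult_eq_scaleR[symmetric])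
  then show ?thesis by (simp add: sum scaleR)
qed

text \<open>Linearity in the direction reduces a direction that varies with the point to the
  finitely many constant directions \<open>axis i 1\<close>, weighted by the smooth components of
  \<open>\<theta>\<close>.\<close>

lemma smooth_dir_deriv_field [smooth_intros]:
  fixes F :: "real ^ 'n \<Rightarrow> 'b::real_normed_vector"
  assumes "open M" "smooth_on M \<theta>" "smooth_on M F"
  shows "smooth_on M (\<lambda>x. dir_deriv (\<theta> x) F x)"
proof (rule smooth_cong)
  show "smooth_on M (\<lambda>x. \<Sum>i\<in>UNIV. \<theta> x $ i *\<^sub>R dir_deriv (axis i 1) F x)"
    by (intro smooth_intros assms)
qed (simp_all add: assms(1) dir_deriv_basis[OF assms(3)])

text \<open>A product rule: the first term freezes the direction at \<open>\<theta> x\<close> and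
  differentiates \<open>F\<close> again, the second differentiates the direction.\<close>

lemma dir_deriv_dir_deriv_field:
  fixes F :: "real ^ 'n \<Rightarrow> 'b::real_normed_vector"
  assumes "open M" "smooth_on M \<theta>" "smooth_on M F" "x \<in> M"
  shows "dir_deriv u (\<lambda>y. dir_deriv (\<theta> y) F y) x =
    dir_deriv u (dir_deriv (\<theta> x) F) x + dir_deriv (dir_deriv u \<theta> x) F x"
proof -
  have expand: "dir_deriv u (\<lambda>y. dir_deriv (\<eta> y) F y) x =
      (\<Sum>i\<in>UNIV. \<eta> x $ i *\<^sub>R dir_deriv u (dir_deriv (axis i 1) F) x) +
      (\<Sum>i\<in>UNIV. dir_deriv u \<eta> x $ i *\<^sub>R dir_deriv (axis i 1) F x)"
    if \<eta>: "smooth_on M \<eta>" for \<eta>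
  proof -
    have comp: "dir_deriv u (\<lambda>y. \<eta> y $ i) x = dir_deriv u \<eta> x $ i" for i
      using dir_deriv_inner[OF smooth_const \<eta> assms(4), of u "axis i 1"]
      by (simp add: inner_axis')
    have "dir_deriv u (\<lambda>y. dir_deriv (\<eta> y) F y) x =
        dir_deriv u (\<lambda>y. \<Sum>i\<in>UNIV. \<eta> y $ i *\<^sub>R dir_deriv (axis i 1) F y) x"
      by (rule dir_deriv_cong[OF assms(1,4)]) (rule dir_deriv_basis[OF assms(3)])
    also have "\<dots> = (\<Sum>i\<in>UNIV. dir_deriv u (\<lambda>y. \<eta> y $ i *\<^sub>R dir_deriv (axis i 1) F y) x)"
      by (intro dir_deriv_sum[OF _ assms(4)] smooth_intros assms(1,3) \<eta>)
    also have "\<dots> = (\<Sum>i\<in>UNIV. \<eta> x $ i *\<^sub>R dir_deriv u (dir_deriv (axis i 1) F) x +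
        dir_deriv u \<eta> x $ i *\<^sub>R dir_deriv (axis i 1) F x)"
      by (intro sum.cong refl, subst dir_deriv_scaleR[of M])
         (auto intro!: smooth_intros assms \<eta> simp: comp)
    finally show ?thesis by (simp add: sum.distrib)
  qed
  show ?thesis
    using expand[OF assms(2)] expand[OF smooth_const, of "\<theta> x"]
      dir_deriv_basis[OF assms(3,4), of "dir_deriv u \<theta> x"]
    by simp
qed

subsection \<open>Symmetry of second derivatives\<close>

text \<open>Allows the symmetry argument to work inside a ball that contains the small
  parallelograms in question.\<close>

lemma smooth_on_subset: "smooth_on M F \<Longrightarrow> N \<subseteq> M \<Longrightarrow> smooth_on N F"
proof -
  have "k_smooth_on k M F \<Longrightarrow> N \<subseteq> M \<Longrightarrow> k_smooth_on k N F" for k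
    by (induction k arbitrary: F) (auto simp: k_smooth_Suc intro: continuous_on_subset)
  then show "smooth_on M F \<Longrightarrow> N \<subseteq> M \<Longrightarrow> smooth_on N F"
    by (auto simp: smooth_on_def)
qed

lemma smooth_isCont: "smooth_on M F \<Longrightarrow> x \<in> M \<Longrightarrow> isCont F x"
  by (rule differentiable_imp_continuous_within[OF smooth_differentiable])

text \<open>
  The left-hand side below is symmetric in \<open>u\<close> and \<open>w\<close>; letting \<open>t\<close> tend to \<open>0\<close> gives Schwarz's theorem.
\<close>

lemma second_difference:
  fixes F :: "'a::real_normed_vector \<Rightarrow> real"
  assumes F: "smooth_on (ball x e) F" and t: "0 < t" "t * (norm u + norm w) < e"
  shows "\<exists>p. norm (p - x) \<le> t * (norm u + norm w) \<and>
    F (x + t *\<^sub>R u + t *\<^sub>R w) - F (x + t *\<^sub>R u) - F (x + t *\<^sub>R w) + F x =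
      t\<^sup>2 * dir_deriv w (dir_deriv u F) p"
proof -
  have near: "norm (a *\<^sub>R u + b *\<^sub>R w) \<le> t * (norm u + norm w)"
    if "0 \<le> a" "a \<le> t" "0 \<le> b" "b \<le> t" for a b
  proof -
    have "norm (a *\<^sub>R u + b *\<^sub>R w) \<le> a * norm u + b * norm w"
      using that norm_triangle_ineq[of "a *\<^sub>R u" "b *\<^sub>R w"] by simp
    also have "\<dots> \<le> t * norm u + t * norm w"
      using that by (intro add_mono mult_right_mono) auto
    finally show ?thesis by (simp add: algebra_simps)
  qed
  then have mem: "x + a *\<^sub>R u + b *\<^sub>R w \<in> ball x e"
    if "0 \<le> a" "a \<le> t" "0 \<le> b" "b \<le> t" for a b
  proof -
    have "dist x (x + a *\<^sub>R u + b *\<^sub>R w) = norm (a *\<^sub>R u + b *\<^sub>R w)"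
      by (metis add.assoc add_diff_cancel_left' dist_commute dist_norm)
    then show ?thesis using near[OF that] t(2) by simp
  qed
  have DERIV: "((\<lambda>s. G (c + s *\<^sub>R v)) has_real_derivative dir_deriv v G (c + s *\<^sub>R v)) (at s)"
    if G: "smooth_on (ball x e) G" and "c + s *\<^sub>R v \<in> ball x e" for G :: "'a \<Rightarrow> real" and c v s
  proof -
    have "((\<lambda>s. c + s *\<^sub>R v) has_derivative (\<lambda>r. r *\<^sub>R v)) (at s)"
      by (auto intro!: derivative_eq_intros)
    from has_derivative_compose[OF this smooth_has_derivative[OF that]]
    have "((\<lambda>s. G (c + s *\<^sub>R v)) has_derivative (\<lambda>r. dir_deriv (r *\<^sub>R v) G (c + s *\<^sub>R v))) (at s)" .
    moreover have "dir_deriv (r *\<^sub>R v) G (c + s *\<^sub>R v) = dir_deriv v G (c + s *\<^sub>R v) * r" for r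
      using linear_scale[OF linear_dir_deriv[OF that]] by simp
    ultimately show ?thesis
      by (simp add: has_field_derivative_def)
  qed
  \<comment> \<open>The mean value theorem is used twice: along \<open>u\<close> for the increment
    of \<open>F\<close> over the step \<open>t *\<^sub>R w\<close>, then along \<open>w\<close> for
    the resulting increment of \<open>dir_deriv u F\<close>.\<close>
  have "((\<lambda>s. F (x + t *\<^sub>R w + s *\<^sub>R u) - F (x + s *\<^sub>R u)) has_real_derivative
      dir_deriv u F (x + t *\<^sub>R w + s *\<^sub>R u) - dir_deriv u F (x + s *\<^sub>R u)) (at s)"
    if "0 \<le> s" "s \<le> t" for s
    using that mem[of s t] mem[of s 0] t(1)
    by (intro DERIV_diff DERIV F) (auto simp: algebra_simps)
  from MVT2[OF t(1) this] obtain \<xi> where \<xi>: "0 < \<xi>" "\<xi> < t"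
    and eq1: "F (x + t *\<^sub>R w + t *\<^sub>R u) - F (x + t *\<^sub>R u) - (F (x + t *\<^sub>R w) - F x) =
      t * (dir_deriv u F (x + t *\<^sub>R w + \<xi> *\<^sub>R u) - dir_deriv u F (x + \<xi> *\<^sub>R u))"
    by auto
  have "((\<lambda>s. dir_deriv u F (x + \<xi> *\<^sub>R u + s *\<^sub>R w)) has_real_derivative
      dir_deriv w (dir_deriv u F) (x + \<xi> *\<^sub>R u + s *\<^sub>R w)) (at s)" if "0 \<le> s" "s \<le> t" for s
    using that mem[of \<xi> s] \<xi> by (intro DERIV smooth_intros F) auto
  from MVT2[OF t(1) this] obtain \<eta> where \<eta>: "0 < \<eta>" "\<eta> < t"
    and eq2: "dir_deriv u F (x + \<xi> *\<^sub>R u + t *\<^sub>R w) - dir_deriv u F (x + \<xi> *\<^sub>R u) =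
      t * dir_deriv w (dir_deriv u F) (x + \<xi> *\<^sub>R u + \<eta> *\<^sub>R w)"
    by auto
  have "norm ((x + \<xi> *\<^sub>R u + \<eta> *\<^sub>R w) - x) \<le> t * (norm u + norm w)"
    using near[of \<xi> \<eta>] \<xi> \<eta> by (simp add: add.assoc)
  moreover have "F (x + t *\<^sub>R u + t *\<^sub>R w) - F (x + t *\<^sub>R u) - F (x + t *\<^sub>R w) + F x =
      t\<^sup>2 * dir_deriv w (dir_deriv u F) (x + \<xi> *\<^sub>R u + \<eta> *\<^sub>R w)"
    using eq1 eq2 by (simp add: algebra_simps power2_eq_square)
  ultimately show ?thesis by blast
qed

lemma dir_deriv_commute_real:
  fixes F :: "'a::real_normed_vector \<Rightarrow> real"
  assumes "open M" "smooth_on M F" "x \<in> M"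
  shows "dir_deriv u (dir_deriv w F) x = dir_deriv w (dir_deriv u F) x"
proof -
  define c where "c = norm u + norm w"
  obtain e where e: "0 < e" "ball x e \<subseteq> M"
    using assms open_contains_ball by blast
  have F: "smooth_on (ball x e) F"
    using smooth_on_subset[OF assms(2) e(2)] .
  have cont: "isCont (dir_deriv a (dir_deriv b F)) x" for a b
    using smooth_isCont[OF smooth_dir_deriv[OF smooth_dir_deriv[OF F]]] e by simp
  have c: "0 \<le> c" by (simp add: c_def)
  \<comment> \<open>A positive null sequence. The summand 1 covers the case where \<open>u\<close>
    and \<open>w\<close> both vanish and keeps \<open>t n * c\<close> strictly below
    \<open>e\<close>.\<close>
  define t where "t n = e / (c + 1) * inverse (real (Suc n))" for n
  have t0: "0 < t n" for n using e c by (simp add: t_def)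
  have te: "t n * c < e" for n
  proof -
    have "inverse (real (Suc n)) \<le> 1" by (simp add: inverse_le_1_iff)
    then have "t n \<le> e / (c + 1)"
      unfolding t_def using e c by (intro mult_right_le_one_le) auto
    then have "t n * c \<le> e / (c + 1) * c"
      using c by (rule mult_right_mono)
    also have "\<dots> < e" using e c by (simp add: divide_less_eq)
    finally show ?thesis .
  qed
  have "(\<lambda>n. e / (c + 1) * inverse (real (Suc n)) * c) \<longlonglongrightarrow> e / (c + 1) * 0 * c"
    by (intro tendsto_mult tendsto_const LIMSEQ_inverse_real_of_nat)
  then have tlim: "(\<lambda>n. t n * c) \<longlonglongrightarrow> 0" unfolding t_def by simp
  have "\<exists>p q. norm (p - x) \<le> t n * c \<and> norm (q - x) \<le> t n * c \<and>
      dir_deriv w (dir_deriv u F) p = dir_deriv u (dir_deriv w F) q" for n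
  proof -
    obtain p where p: "norm (p - x) \<le> t n * c"
      "F (x + t n *\<^sub>R u + t n *\<^sub>R w) - F (x + t n *\<^sub>R u) - F (x + t n *\<^sub>R w) + F x =
        (t n)\<^sup>2 * dir_deriv w (dir_deriv u F) p"
      using second_difference[OF F t0, of n u w] te[of n] by (auto simp: c_def)
    obtain q where q: "norm (q - x) \<le> t n * c"
      "F (x + t n *\<^sub>R w + t n *\<^sub>R u) - F (x + t n *\<^sub>R w) - F (x + t n *\<^sub>R u) + F x =
        (t n)\<^sup>2 * dir_deriv u (dir_deriv w F) q"
      using second_difference[OF F t0, of n w u] te[of n] by (auto simp: c_def add.commute)
    have "(t n)\<^sup>2 * dir_deriv w (dir_deriv u F) p = (t n)\<^sup>2 * dir_deriv u (dir_deriv w F) q"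
        using p(2) q(2) by (simp add: algebra_simps)
    then have "dir_deriv w (dir_deriv u F) p = dir_deriv u (dir_deriv w F) q"
      using t0[of n] by simp
    then show ?thesis using p(1) q(1) by blast
  qed
  then obtain p q where pq: "\<And>n. norm (p n - x) \<le> t n * c" "\<And>n. norm (q n - x) \<le> t n * c"
    "\<And>n. dir_deriv w (dir_deriv u F) (p n) = dir_deriv u (dir_deriv w F) (q n)"
    by metis
  have "p \<longlonglongrightarrow> x" "q \<longlonglongrightarrow> x"
    using Lim_null_comparison[OF _ tlim, of "\<lambda>n. p n - x"]
      Lim_null_comparison[OF _ tlim, of "\<lambda>n. q n - x"] pq(1,2)
    by (simp_all add: LIM_zero_iff)
  then have "(\<lambda>n. dir_deriv w (dir_deriv u F) (p n)) \<longlonglongrightarrow> dir_deriv w (dir_deriv u F) x"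
    "(\<lambda>n. dir_deriv u (dir_deriv w F) (q n)) \<longlonglongrightarrow> dir_deriv u (dir_deriv w F) x"
    using isCont_tendsto_compose[OF cont] by auto
  then show ?thesis
    unfolding pq(3) by (rule LIMSEQ_unique[symmetric])
qed

text \<open>The mean value theorem is a scalar statement, so the vector-valued case is settled one
  basis component at a time.\<close>

lemma dir_deriv_commute:
  fixes F :: "'a::real_normed_vector \<Rightarrow> 'b::euclidean_space"
  assumes "open M" "smooth_on M F" "x \<in> M"
  shows "dir_deriv u (dir_deriv w F) x = dir_deriv w (dir_deriv u F) x"
proof (rule euclidean_eqI)
  fix b :: 'b
  have D: "dir_deriv v (\<lambda>y. G y \<bullet> b) y = dir_deriv v G y \<bullet> b"
    if "smooth_on M G" "y \<in> M" for G :: "'a \<Rightarrow> 'b" and v y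
    using dir_deriv_inner[OF that(1) smooth_const that(2)] by simp
  have DD: "dir_deriv u (dir_deriv w (\<lambda>y. F y \<bullet> b)) x = dir_deriv u (dir_deriv w F) x \<bullet> b" for u w
  proof -
    have "dir_deriv u (dir_deriv w (\<lambda>y. F y \<bullet> b)) x = dir_deriv u (\<lambda>y. dir_deriv w F y \<bullet> b) x"
      by (intro dir_deriv_cong[OF assms(1,3)] D assms(2))
    then show ?thesis using D[OF smooth_dir_deriv[OF assms(2)] assms(3)] by simp
  qed
  have "smooth_on M (\<lambda>y. F y \<bullet> b)"
    by (intro smooth_intros assms)
  from dir_deriv_commute_real[OF assms(1) this assms(3)]
  show "dir_deriv u (dir_deriv w F) x \<bullet> b = dir_deriv w (dir_deriv u F) x \<bullet> b"
    by (simp only: DD)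
qed

subsection \<open>Lie derivatives and brackets\<close>

lemma lie_deriv_eq: "lie_deriv \<theta> F x = dir_deriv (\<theta> x) F x"
  by (simp add: lie_deriv_def dir_deriv_def)

lemma lie_bracket_eq: "lie_bracket a b x = dir_deriv (a x) b x - dir_deriv (b x) a x"
  by (simp add: lie_bracket_def dir_deriv_def)

lemma differential_inner:
  assumes "smooth_on M F" "x \<in> M"
  shows "differential F x \<bullet> v = dir_deriv v F x"
proof -
  have "differential F x \<bullet> v = (\<Sum>i\<in>UNIV. v $ i * dir_deriv (axis i 1) F x)"
    by (simp add: differential_def inner_vec_def dir_deriv_def mult.commute)
  then show ?thesis
    using dir_deriv_basis[OF assms, of v] by simp
qed

text \<open>Pairing with a constant vector turns the row-times-matrix term into a directional
  derivative of \<open>\<theta>\<close>. The covector identities that follow are proved by testing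
  against every such vector.\<close>

lemma lie_deriv_covec_inner:
  assumes "smooth_on M \<theta>" "x \<in> M"
  shows "lie_deriv_covec \<theta> \<omega> x \<bullet> v = dir_deriv (\<theta> x) \<omega> x \<bullet> v + \<omega> x \<bullet> dir_deriv v \<theta> x"
proof -
  have "matrix (frechet_derivative \<theta> (at x)) *v v = dir_deriv v \<theta> x"
    using linear_dir_deriv[OF assms] matrix_works[of "\<lambda>v. dir_deriv v \<theta> x" v]
    by (simp add: linear_matrix_vector_mul_eq dir_deriv_def)
  then show ?thesis
    by (simp add: lie_deriv_covec_def dot_lmul_matrix inner_add_left dir_deriv_def)
qed

lemma smooth_lie_deriv [smooth_intros]:
  "open M \<Longrightarrow> smooth_on M \<theta> \<Longrightarrow> smooth_on M F \<Longrightarrow> smooth_on M (lie_deriv \<theta> F)"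
  unfolding lie_deriv_eq[abs_def] by (intro smooth_intros)

lemma smooth_lie_bracket [smooth_intros]:
  "open M \<Longrightarrow> smooth_on M a \<Longrightarrow> smooth_on M b \<Longrightarrow> smooth_on M (lie_bracket a b)"
  unfolding lie_bracket_eq[abs_def] by (intro smooth_intros)

lemma smooth_differential [smooth_intros]:
  assumes "open M" "smooth_on M F"
  shows "smooth_on M (differential F)"
  using smooth_dir_deriv[OF assms(2)]
  by (intro smooth_componentwise assms(1)) (simp add: differential_def dir_deriv_def)

lemma smooth_lie_deriv_covec [smooth_intros]:
  assumes "open M" "smooth_on M \<theta>" "smooth_on M \<omega>"
  shows "smooth_on M (lie_deriv_covec \<theta> \<omega>)"
proof (rule smooth_componentwise[OF assms(1)])
  fix i
  have "smooth_on M (\<lambda>x. dir_deriv (\<theta> x) \<omega> x \<bullet> axis i 1 + \<omega> x \<bullet> dir_deriv (axis i 1) \<theta> x)"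
    by (intro smooth_intros assms)
  then show "smooth_on M (\<lambda>x. lie_deriv_covec \<theta> \<omega> x $ i)"
  proof (rule smooth_cong)
    show "dir_deriv (\<theta> x) \<omega> x \<bullet> axis i 1 + \<omega> x \<bullet> dir_deriv (axis i 1) \<theta> x =
        lie_deriv_covec \<theta> \<omega> x $ i" if "x \<in> M" for x
      using lie_deriv_covec_inner[OF assms(2) that, of \<omega> "axis i 1"] by (simp add: inner_axis)
  qed (rule assms(1))
qed

lemma lie_deriv_cong:
  assumes "open M" "x \<in> M" "\<And>y. y \<in> M \<Longrightarrow> \<theta> y = \<eta> y" "\<And>y. y \<in> M \<Longrightarrow> F y = G y"
  shows "lie_deriv \<theta> F x = lie_deriv \<eta> G x"
  unfolding lie_deriv_eq assms(3)[OF assms(2)]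
  by (rule dir_deriv_cong[OF assms(1,2)]) (rule assms(4))

lemma differential_cong:
  assumes "open M" "x \<in> M" "\<And>y. y \<in> M \<Longrightarrow> F y = G y"
  shows "differential F x = differential G x"
proof -
  have "dir_deriv v F x = dir_deriv v G x" for v
    by (rule dir_deriv_cong[OF assms(1,2)]) (rule assms(3))
  then show ?thesis by (simp add: differential_def dir_deriv_def)
qed

lemma lie_deriv_covec_cong:
  assumes "open M" "x \<in> M" "\<And>y. y \<in> M \<Longrightarrow> \<theta> y = \<eta> y" "\<And>y. y \<in> M \<Longrightarrow> \<omega> y = \<omega>' y"
  shows "lie_deriv_covec \<theta> \<omega> x = lie_deriv_covec \<eta> \<omega>' x"
proof -
  have "dir_deriv v \<theta> x = dir_deriv v \<eta> x" for v
    by (rule dir_deriv_cong[OF assms(1,2)]) (rule assms(3))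
  moreover have "dir_deriv v \<omega> x = dir_deriv v \<omega>' x" for v
    by (rule dir_deriv_cong[OF assms(1,2)]) (rule assms(4))
  ultimately have "frechet_derivative \<theta> (at x) = frechet_derivative \<eta> (at x)"
    "frechet_derivative \<omega> (at x) = frechet_derivative \<omega>' (at x)"
    by (simp_all add: dir_deriv_def fun_eq_iff)
  then show ?thesis
    using assms(2-4) by (simp add: lie_deriv_covec_def)
qed

lemma dir_deriv_differential_inner:
  assumes "open M" "smooth_on M F" "x \<in> M"
  shows "dir_deriv u (differential F) x \<bullet> v = dir_deriv u (dir_deriv v F) x"
proof -
  have "dir_deriv u (differential F) x \<bullet> v = dir_deriv u (\<lambda>y. differential F y \<bullet> v) x"
    using dir_deriv_inner[OF smooth_differential[OF assms(1,2)] smooth_const assms(3)] by simp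
  also have "\<dots> = dir_deriv u (dir_deriv v F) x"
    by (intro dir_deriv_cong[OF assms(1,3)] differential_inner[OF assms(2)])
  finally show ?thesis .
qed

text \<open>Tested on \<open>v\<close>, both sides contain the derivative of \<open>F\<close> along
  \<open>dir_deriv v \<theta> x\<close> and a second derivative of \<open>F\<close> in the
  directions \<open>\<theta> x\<close> and \<open>v\<close>; they differ only in the order of the
  latter.\<close>

lemma lie_deriv_covec_differential:
  assumes "open M" "smooth_on M \<theta>" "smooth_on M F" "x \<in> M"
  shows "lie_deriv_covec \<theta> (differential F) x = differential (lie_deriv \<theta> F) x"
proof -
  have "lie_deriv_covec \<theta> (differential F) x \<bullet> v = differential (lie_deriv \<theta> F) x \<bullet> v" for v
  proof -
    have "differential (lie_deriv \<theta> F) x \<bullet> v = dir_deriv v (\<lambda>y. dir_deriv (\<theta> y) F y) x"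
      using differential_inner[OF smooth_lie_deriv[OF assms(1-3)] assms(4)]
      by (simp add: lie_deriv_eq[abs_def])
    then show ?thesis
      unfolding dir_deriv_dir_deriv_field[OF assms]
      using dir_deriv_commute[OF assms(1,3,4), of "\<theta> x" v]
      by (simp add: lie_deriv_covec_inner[OF assms(2,4)] differential_inner[OF assms(3,4)]
          dir_deriv_differential_inner[OF assms(1,3,4)])
  qed
  then show ?thesis by (rule vector_eq_rdot[THEN iffD1, OF allI])
qed

text \<open>The second derivatives of \<open>F\<close> cancel by symmetry, and the remaining
  first-order terms are the derivative along the bracket.\<close>

lemma lie_deriv_lie_bracket:
  assumes "open M" "smooth_on M a" "smooth_on M b" "smooth_on M F" "x \<in> M"
  shows "lie_deriv (lie_bracket a b) F x =
    lie_deriv a (lie_deriv b F) x - lie_deriv b (lie_deriv a F) x"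
  unfolding lie_deriv_eq[abs_def] lie_bracket_eq
    dir_deriv_dir_deriv_field[OF assms(1,2,4,5)] dir_deriv_dir_deriv_field[OF assms(1,3,4,5)]
  using dir_deriv_commute[OF assms(1,4,5), of "a x" "b x"]
    linear_diff[OF linear_dir_deriv[OF assms(4,5)]]
  by simp

text \<open>Prepares the commutator: under exchange of \<open>a\<close> and \<open>b\<close> the
  first term is symmetric by Schwarz's theorem, and the third and fifth are interchanged.\<close>

lemma lie_deriv_covec_lie_deriv_covec_inner:
  assumes "open M" "smooth_on M a" "smooth_on M b" "smooth_on M \<omega>" "x \<in> M"
  shows "lie_deriv_covec a (lie_deriv_covec b \<omega>) x \<bullet> v =
    dir_deriv (a x) (dir_deriv (b x) \<omega>) x \<bullet> v + dir_deriv (dir_deriv (a x) b x) \<omega> x \<bullet> v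
    + dir_deriv (a x) \<omega> x \<bullet> dir_deriv v b x + \<omega> x \<bullet> dir_deriv (a x) (dir_deriv v b) x
    + dir_deriv (b x) \<omega> x \<bullet> dir_deriv v a x + \<omega> x \<bullet> dir_deriv (dir_deriv v a x) b x"
proof -
  let ?Lb = "lie_deriv_covec b \<omega>"
  have "dir_deriv (a x) ?Lb x \<bullet> v = dir_deriv (a x) (\<lambda>y. ?Lb y \<bullet> v) x"
    using dir_deriv_inner[OF smooth_lie_deriv_covec[OF assms(1,3,4)] smooth_const assms(5)] by simp
  also have "\<dots> = dir_deriv (a x) (\<lambda>y. dir_deriv (b y) \<omega> y \<bullet> v + \<omega> y \<bullet> dir_deriv v b y) x"
    by (intro dir_deriv_cong[OF assms(1,5)] lie_deriv_covec_inner[OF assms(3)])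
  also have "\<dots> = dir_deriv (a x) (\<lambda>y. dir_deriv (b y) \<omega> y \<bullet> v) x
      + dir_deriv (a x) (\<lambda>y. \<omega> y \<bullet> dir_deriv v b y) x"
    by (intro dir_deriv_add[of M] smooth_intros assms)
  also have "dir_deriv (a x) (\<lambda>y. dir_deriv (b y) \<omega> y \<bullet> v) x =
      dir_deriv (a x) (dir_deriv (b x) \<omega>) x \<bullet> v + dir_deriv (dir_deriv (a x) b x) \<omega> x \<bullet> v"
    using dir_deriv_inner[OF smooth_dir_deriv_field[OF assms(1,3,4)] smooth_const assms(5)]
    by (simp add: dir_deriv_dir_deriv_field[OF assms(1,3,4,5)] inner_add_left)
  also have "dir_deriv (a x) (\<lambda>y. \<omega> y \<bullet> dir_deriv v b y) x =
      \<omega> x \<bullet> dir_deriv (a x) (dir_deriv v b) x + dir_deriv (a x) \<omega> x \<bullet> dir_deriv v b x"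
    by (intro dir_deriv_inner[of M] smooth_intros assms)
  finally show ?thesis
    by (simp add: lie_deriv_covec_inner[OF assms(2,5)] lie_deriv_covec_inner[OF assms(3,5)]
        inner_add_left)
qed

text \<open>After antisymmetrising the six-term expansion, the second term leaves the derivative of
  \<open>\<omega>\<close> along the bracket, while the fourth and sixth leave
  \<open>\<omega>\<close> paired with the derivative of the bracket.\<close>

lemma lie_deriv_covec_lie_bracket:
  assumes "open M" "smooth_on M a" "smooth_on M b" "smooth_on M \<omega>" "x \<in> M"
  shows "lie_deriv_covec (lie_bracket a b) \<omega> x =
    lie_deriv_covec a (lie_deriv_covec b \<omega>) x - lie_deriv_covec b (lie_deriv_covec a \<omega>) x"
proof -
  have "lie_deriv_covec (lie_bracket a b) \<omega> x \<bullet> v =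
      lie_deriv_covec a (lie_deriv_covec b \<omega>) x \<bullet> v - lie_deriv_covec b (lie_deriv_covec a \<omega>) x \<bullet> v"
    for v
  proof -
    have "dir_deriv v (lie_bracket a b) x =
        dir_deriv v (\<lambda>y. dir_deriv (a y) b y) x - dir_deriv v (\<lambda>y. dir_deriv (b y) a y) x"
      unfolding lie_bracket_eq[abs_def] by (intro dir_deriv_diff[of M] smooth_intros assms)
    also have "\<dots> = dir_deriv (a x) (dir_deriv v b) x + dir_deriv (dir_deriv v a x) b x
        - dir_deriv (b x) (dir_deriv v a) x - dir_deriv (dir_deriv v b x) a x"
      unfolding dir_deriv_dir_deriv_field[OF assms(1,2,3,5)] dir_deriv_dir_deriv_field[OF assms(1,3,2,5)]
      using dir_deriv_commute[OF assms(1,3,5), of v "a x"] dir_deriv_commute[OF assms(1,2,5), of v "b x"]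
      by simp
    finally have D: "dir_deriv v (lie_bracket a b) x = \<dots>" .
    have "dir_deriv (dir_deriv (a x) b x - dir_deriv (b x) a x) \<omega> x =
        dir_deriv (dir_deriv (a x) b x) \<omega> x - dir_deriv (dir_deriv (b x) a x) \<omega> x"
      using linear_diff[OF linear_dir_deriv[OF assms(4,5)]] .
    then show ?thesis
      using dir_deriv_commute[OF assms(1,4,5), of "a x" "b x"]
      unfolding lie_deriv_covec_lie_deriv_covec_inner[OF assms]
        lie_deriv_covec_lie_deriv_covec_inner[OF assms(1,3,2,4,5)]
        lie_deriv_covec_inner[OF smooth_lie_bracket[OF assms(1-3)] assms(5)] D lie_bracket_eq
      by (simp add: inner_add_right inner_diff_left inner_diff_right)
  qed
  then show ?thesis
    unfolding inner_diff_left[symmetric] by (rule vector_eq_rdot[THEN iffD1, OF allI])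
qed

section \<open>Combinations of vector fields, and product rules\<close>

lemma lie_deriv_add_scaleR_field:
  assumes "smooth_on M F" "x \<in> M"
  shows "lie_deriv (\<lambda>y. a y + c y *\<^sub>R b y) F x = lie_deriv a F x + c x * lie_deriv b F x"
  using linear_add[OF linear_dir_deriv[OF assms]] linear_scale[OF linear_dir_deriv[OF assms]]
  by (simp add: lie_deriv_eq)

text \<open>The Lie derivative of a covector field also differentiates the vector field, so the
  coefficient \<open>c\<close> contributes its differential. This term is why differentials of
  \<open>\<mu> k\<close> must be controlled later.\<close>

lemma lie_deriv_covec_add_scaleR_field:
  assumes "open M" "smooth_on M a" "smooth_on M b" "smooth_on M c" "smooth_on M \<omega>" "x \<in> M"
  shows "lie_deriv_covec (\<lambda>y. a y + c y *\<^sub>R b y) \<omega> x =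
    lie_deriv_covec a \<omega> x + c x *\<^sub>R lie_deriv_covec b \<omega> x + (\<omega> x \<bullet> b x) *\<^sub>R differential c x"
proof -
  have field: "smooth_on M (\<lambda>y. a y + c y *\<^sub>R b y)"
    by (intro smooth_intros assms)
  have "dir_deriv v (\<lambda>y. a y + c y *\<^sub>R b y) x =
      dir_deriv v a x + c x *\<^sub>R dir_deriv v b x + dir_deriv v c x *\<^sub>R b x" for v
    using assms by (subst dir_deriv_add[of M]) (auto intro!: smooth_intros simp: dir_deriv_scaleR)
  moreover have "dir_deriv (a x + c x *\<^sub>R b x) \<omega> x =
      dir_deriv (a x) \<omega> x + c x *\<^sub>R dir_deriv (b x) \<omega> x"
    using linear_add[OF linear_dir_deriv[OF assms(5,6)]]
      linear_scale[OF linear_dir_deriv[OF assms(5,6)]] by simp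
  ultimately have "lie_deriv_covec (\<lambda>y. a y + c y *\<^sub>R b y) \<omega> x \<bullet> v =
      (lie_deriv_covec a \<omega> x + c x *\<^sub>R lie_deriv_covec b \<omega> x + (\<omega> x \<bullet> b x) *\<^sub>R differential c x) \<bullet> v"
    for v
    using assms(2-6) field
    by (simp add: lie_deriv_covec_inner[of M] differential_inner[of M] algebra_simps
        inner_add_left inner_add_right)
  then show ?thesis by (rule vector_eq_rdot[THEN iffD1, OF allI])
qed

lemma lie_bracket_scaleR_right:
  assumes "smooth_on M c" "smooth_on M b" "x \<in> M" "smooth_on M a"
  shows "lie_bracket a (\<lambda>y. c y *\<^sub>R b y) x = c x *\<^sub>R lie_bracket a b x + lie_deriv a c x *\<^sub>R b x"
  using assms linear_scale[OF linear_dir_deriv[OF assms(4,3)]]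
  by (simp add: lie_bracket_eq lie_deriv_eq dir_deriv_scaleR algebra_simps)

lemma lie_deriv_mult:
  assumes "smooth_on M F" "smooth_on M G" "x \<in> M"
  shows "lie_deriv \<theta> (\<lambda>y. F y * G y) x = F x * lie_deriv \<theta> G x + lie_deriv \<theta> F x * G x"
  using assms by (simp add: lie_deriv_eq dir_deriv_mult)

lemma differential_add:
  assumes "smooth_on M F" "smooth_on M G" "x \<in> M"
  shows "differential (\<lambda>y. F y + G y) x = differential F x + differential G x"
  using dir_deriv_add[OF assms] by (simp add: differential_def dir_deriv_def vec_eq_iff)

lemma differential_diff:
  assumes "smooth_on M F" "smooth_on M G" "x \<in> M"
  shows "differential (\<lambda>y. F y - G y) x = differential F x - differential G x"
  using dir_deriv_diff[OF assms] by (simp add: differential_def dir_deriv_def vec_eq_iff)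

lemma differential_mult:
  assumes "smooth_on M F" "smooth_on M G" "x \<in> M"
  shows "differential (\<lambda>y. F y * G y) x = F x *\<^sub>R differential G x + G x *\<^sub>R differential F x"
  using dir_deriv_mult[OF assms]
  by (simp add: differential_def dir_deriv_def vec_eq_iff mult.commute)

subsection \<open>Codistributions\<close>

lemma codist_spanI:
  assumes "finite B" "B \<subseteq> S" "\<And>\<eta>. \<eta> \<in> B \<Longrightarrow> smooth_on M (c \<eta> :: real ^ 'n \<Rightarrow> real)"
    and "\<And>x. x \<in> M \<Longrightarrow> \<omega> x = (\<Sum>\<eta>\<in>B. c \<eta> x *\<^sub>R \<eta> x)"
  shows "\<omega> \<in> codist_span M S"
  using assms by (auto simp: codist_span_def)

lemma codist_spanE:
  assumes "\<omega> \<in> codist_span M S"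
  obtains B and c :: "(real ^ 'n \<Rightarrow> real ^ 'n) \<Rightarrow> real ^ 'n \<Rightarrow> real"
  where "finite B" "B \<subseteq> S" "\<And>\<eta>. \<eta> \<in> B \<Longrightarrow> smooth_on M (c \<eta>)"
    "\<And>x. x \<in> M \<Longrightarrow> \<omega> x = (\<Sum>\<eta>\<in>B. c \<eta> x *\<^sub>R \<eta> x)"
proof -
  obtain B and c :: "(real ^ 'n \<Rightarrow> real ^ 'n) \<Rightarrow> real ^ 'n \<Rightarrow> real" where
    "finite B \<and> B \<subseteq> S \<and> (\<forall>\<eta>\<in>B. smooth_on M (c \<eta>)) \<and>
      (\<forall>x\<in>M. \<omega> x = (\<Sum>\<eta>\<in>B. c \<eta> x *\<^sub>R \<eta> x))"
    using assms unfolding codist_span_def by blast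
  then show ?thesis
    by (intro that[of B c]) auto
qed

lemma codist_span_base: "\<omega> \<in> S \<Longrightarrow> \<omega> \<in> codist_span M S"
  by (rule codist_spanI[where B = "{\<omega>}" and c = "\<lambda>_ _. 1"]) (auto intro: smooth_intros)

lemma codist_span_cong:
  "\<omega> \<in> codist_span M S \<Longrightarrow> (\<And>x. x \<in> M \<Longrightarrow> \<omega>' x = \<omega> x) \<Longrightarrow> \<omega>' \<in> codist_span M S"
  by (auto simp: codist_span_def)

lemma codist_span_zero: "(\<lambda>x. 0) \<in> codist_span M S"
  by (rule codist_spanI[where B = "{}"]) auto

lemma codist_span_add:
  assumes "open M" "\<omega> \<in> codist_span M S" "\<omega>' \<in> codist_span M S"
  shows "(\<lambda>x. \<omega> x + \<omega>' x) \<in> codist_span M S"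
proof -
  obtain B c where B: "finite B" "B \<subseteq> S" "\<And>\<eta>. \<eta> \<in> B \<Longrightarrow> smooth_on M (c \<eta>)"
    "\<And>x. x \<in> M \<Longrightarrow> \<omega> x = (\<Sum>\<eta>\<in>B. c \<eta> x *\<^sub>R \<eta> x)"
    using assms(2) by (rule codist_spanE) blast
  obtain B' c' where B': "finite B'" "B' \<subseteq> S" "\<And>\<eta>. \<eta> \<in> B' \<Longrightarrow> smooth_on M (c' \<eta>)"
    "\<And>x. x \<in> M \<Longrightarrow> \<omega>' x = (\<Sum>\<eta>\<in>B'. c' \<eta> x *\<^sub>R \<eta> x)"
    using assms(3) by (rule codist_spanE) blast
  \<comment> \<open>Nothing is known about \<open>c\<close> outside \<open>B\<close>. Extension by
    zero gives smooth coefficients on the union, so the two sums can be added term by term.\<close>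
  define d where "d \<eta> = (if \<eta> \<in> B then c \<eta> else (\<lambda>x. 0))" for \<eta>
  define d' where "d' \<eta> = (if \<eta> \<in> B' then c' \<eta> else (\<lambda>x. 0))" for \<eta>
  have d: "smooth_on M (d \<eta>)" "smooth_on M (d' \<eta>)" for \<eta>
    using B(3) B'(3) by (auto simp: d_def d'_def intro: smooth_intros)
  show ?thesis
  proof (rule codist_spanI[where B = "B \<union> B'" and c = "\<lambda>\<eta> x. d \<eta> x + d' \<eta> x"])
    fix x assume x: "x \<in> M"
    have "\<omega> x = (\<Sum>\<eta>\<in>B \<union> B'. d \<eta> x *\<^sub>R \<eta> x)"
      unfolding B(4)[OF x] using B(1) B'(1)
      by (intro sum.mono_neutral_cong_left) (auto simp: d_def)
    moreover have "\<omega>' x = (\<Sum>\<eta>\<in>B \<union> B'. d' \<eta> x *\<^sub>R \<eta> x)"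
      unfolding B'(4)[OF x] using B(1) B'(1)
      by (intro sum.mono_neutral_cong_left) (auto simp: d'_def)
    ultimately show "\<omega> x + \<omega>' x = (\<Sum>\<eta>\<in>B \<union> B'. (d \<eta> x + d' \<eta> x) *\<^sub>R \<eta> x)"
      by (simp add: scaleR_add_left sum.distrib)
  qed (use B(1,2) B'(1,2) in \<open>auto intro!: smooth_add assms(1) d\<close>)
qed

lemma codist_span_scale:
  assumes "open M" "smooth_on M a" "\<omega> \<in> codist_span M S"
  shows "(\<lambda>x. a x *\<^sub>R \<omega> x) \<in> codist_span M S"
proof -
  obtain B c where B: "finite B" "B \<subseteq> S" "\<And>\<eta>. \<eta> \<in> B \<Longrightarrow> smooth_on M (c \<eta>)"
    "\<And>x. x \<in> M \<Longrightarrow> \<omega> x = (\<Sum>\<eta>\<in>B. c \<eta> x *\<^sub>R \<eta> x)"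
    using assms(3) by (rule codist_spanE) blast
  then show ?thesis
    by (intro codist_spanI[where B = B and c = "\<lambda>\<eta> x. a x * c \<eta> x"] smooth_mult assms)
       (auto simp: scaleR_sum_right)
qed

lemma codist_span_diff:
  assumes "open M" "\<omega> \<in> codist_span M S" "\<omega>' \<in> codist_span M S"
  shows "(\<lambda>x. \<omega> x - \<omega>' x) \<in> codist_span M S"
  using codist_span_add[OF assms(1,2) codist_span_scale[OF assms(1) smooth_const assms(3), of "-1"]]
  by simp

lemma codist_span_sum:
  assumes "open M" "\<And>i. i \<in> I \<Longrightarrow> \<omega> i \<in> codist_span M S"
  shows "(\<lambda>x. \<Sum>i\<in>I. \<omega> i x) \<in> codist_span M S"
  using assms(2)
  by (induction I rule: infinite_finite_induct)
     (auto intro: codist_span_zero codist_span_add[OF assms(1)])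

text \<open>Smooth combinations of smooth combinations are again smooth combinations, so inclusion
  of a span need only be checked on its generators.\<close>

lemma codist_span_minimal:
  assumes "open M" "S \<subseteq> codist_span M T"
  shows "codist_span M S \<subseteq> codist_span M T"
proof
  fix \<omega> assume "\<omega> \<in> codist_span M S"
  then obtain B c where B: "finite B" "B \<subseteq> S" "\<And>\<eta>. \<eta> \<in> B \<Longrightarrow> smooth_on M (c \<eta>)"
    "\<And>x. x \<in> M \<Longrightarrow> \<omega> x = (\<Sum>\<eta>\<in>B. c \<eta> x *\<^sub>R \<eta> x)"
    by (rule codist_spanE) blast
  have "(\<lambda>x. \<Sum>\<eta>\<in>B. c \<eta> x *\<^sub>R \<eta> x) \<in> codist_span M T"
    using B(2,3) assms by (intro codist_span_sum codist_span_scale) auto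
  then show "\<omega> \<in> codist_span M T"
    using B(4) by (rule codist_span_cong)
qed

lemma codist_span_smooth:
  assumes "open M" "\<And>\<eta>. \<eta> \<in> S \<Longrightarrow> smooth_on M \<eta>" "\<omega> \<in> codist_span M S"
  shows "smooth_on M \<omega>"
proof -
  obtain B c where B: "finite B" "B \<subseteq> S" "\<And>\<eta>. \<eta> \<in> B \<Longrightarrow> smooth_on M (c \<eta>)"
    "\<And>x. x \<in> M \<Longrightarrow> \<omega> x = (\<Sum>\<eta>\<in>B. c \<eta> x *\<^sub>R \<eta> x)"
    using assms(3) by (rule codist_spanE) blast
  have "smooth_on M (\<lambda>x. \<Sum>\<eta>\<in>B. c \<eta> x *\<^sub>R \<eta> x)"
    using B(2,3) assms(2) by (intro smooth_sum smooth_scaleR assms(1)) auto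
  then show ?thesis
    using assms(1) by (rule smooth_cong) (simp add: B(4))
qed

lemma codist_invariantD:
  "codist_invariant M \<theta> \<Omega> \<Longrightarrow> \<omega> \<in> \<Omega> \<Longrightarrow> lie_deriv_covec \<theta> \<omega> \<in> \<Omega>"
  unfolding codist_invariant_def lie_codist_def using codist_span_base by blast

subsection \<open>The stationary codistribution\<close>

locale lie_system =
  fixes M :: "(real ^ 'n) set"
    and f g :: "real ^ 'n \<Rightarrow> real ^ 'n"
    and h :: "real ^ 'n \<Rightarrow> real"
  assumes M: "open M"
    and f: "smooth_on M f" and g: "smooth_on M g" and h: "smooth_on M h"
    and L_nonzero: "\<forall>x\<in>M. lie_deriv g h x \<noteq> 0"
begin

abbreviation L where "L \<equiv> lie_deriv g h"
abbreviation G where "G \<equiv> g_normalized g h"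
abbreviation \<phi> where "\<phi> \<equiv> phi f g h"

section \<open>The normalized field and the recursions for \<open>\<phi>\<close> and
  \<open>\<mu>\<close>\<close>

definition \<mu> where "\<mu> k = (\<lambda>x. lie_deriv (\<phi> k) L x / L x)"

lemma smooth_L: "smooth_on M L"
  by (intro smooth_intros M g h)

lemma smooth_G: "smooth_on M G"
  unfolding g_normalized_def by (intro smooth_intros M g smooth_L L_nonzero)

lemma smooth_tau: "smooth_on M (tau g h)"
  unfolding tau_def using L_nonzero by (intro smooth_intros M g smooth_L) simp

lemma smooth_phi: "smooth_on M (\<phi> k)"
proof (induction k)
  case (Suc k)
  have "smooth_on M (\<lambda>x. inverse (L x) *\<^sub>R lie_bracket (\<phi> k) g x)"
    by (intro smooth_intros M Suc g smooth_L L_nonzero)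
  then show ?case by (simp add: phi.simps(2))
qed (simp add: f)

lemma smooth_mu: "smooth_on M (\<mu> k)"
  unfolding \<mu>_def by (intro smooth_intros M smooth_phi smooth_L L_nonzero)

lemma lie_deriv_g_normalized:
  assumes "smooth_on M F" "x \<in> M"
  shows "lie_deriv G F x = lie_deriv g F x / L x"
  using linear_scale[OF linear_dir_deriv[OF assms]]
  unfolding lie_deriv_eq[of G] lie_deriv_eq[of g F]
  unfolding g_normalized_def by (simp add: divide_inverse)

lemma lie_deriv_G_h: "x \<in> M \<Longrightarrow> lie_deriv G h x = 1"
  using lie_deriv_g_normalized[OF h] L_nonzero by simp

lemma lie_deriv_G_L: "x \<in> M \<Longrightarrow> lie_deriv G L x = L x * tau g h x"
  using lie_deriv_g_normalized[OF smooth_L] L_nonzero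
  by (simp add: tau_def power2_eq_square)

text \<open>On \<open>M\<close> the field \<open>g\<close> is \<open>L\<close> times
  \<open>G\<close>; the bracket rule for a scaled field and division by \<open>L\<close> replace
  \<open>g\<close> by \<open>G\<close>, along which invariance is assumed.\<close>

lemma phi_Suc_eq:
  assumes "x \<in> M"
  shows "\<phi> (Suc k) x = lie_bracket (\<phi> k) G x + \<mu> k x *\<^sub>R G x"
proof -
  have "g y = L y *\<^sub>R G y" if "y \<in> M" for y
    using L_nonzero that by (simp add: g_normalized_def)
  then have "lie_bracket (\<phi> k) g x = lie_bracket (\<phi> k) (\<lambda>y. L y *\<^sub>R G y) x"
    using dir_deriv_cong[OF M assms, of g "\<lambda>y. L y *\<^sub>R G y"] assms by (simp add: lie_bracket_eq)
  also have "\<dots> = L x *\<^sub>R lie_bracket (\<phi> k) G x + lie_deriv (\<phi> k) L x *\<^sub>R G x"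
    by (rule lie_bracket_scaleR_right[OF smooth_L smooth_G assms smooth_phi])
  finally show ?thesis
    using L_nonzero assms by (simp add: scaleR_add_right \<mu>_def divide_inverse mult.commute)
qed

lemma lie_deriv_phi_Suc:
  assumes F: "smooth_on M F" and x: "x \<in> M"
  shows "lie_deriv (\<phi> (Suc k)) F x =
    lie_deriv (\<phi> k) (lie_deriv G F) x - lie_deriv G (lie_deriv (\<phi> k) F) x + \<mu> k x * lie_deriv G F x"
proof -
  have "lie_deriv (\<phi> (Suc k)) F x = lie_deriv (\<lambda>y. lie_bracket (\<phi> k) G y + \<mu> k y *\<^sub>R G y) F x"
    by (rule lie_deriv_cong[OF M x phi_Suc_eq refl])
  then show ?thesis
    by (simp only: lie_deriv_add_scaleR_field[OF F x]
        lie_deriv_lie_bracket[OF M smooth_phi smooth_G F x])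
qed

text \<open>Shows what passing from \<open>\<phi> k\<close> to \<open>\<phi> (Suc k)\<close>
  requires: the first three terms only use Lie derivatives along \<open>\<phi> k\<close> and
  \<open>G\<close>, and the last needs \<open>differential (\<mu> k)\<close>.\<close>

lemma lie_deriv_covec_phi_Suc:
  assumes \<omega>: "smooth_on M \<omega>" and x: "x \<in> M"
  shows "lie_deriv_covec (\<phi> (Suc k)) \<omega> x =
    lie_deriv_covec (\<phi> k) (lie_deriv_covec G \<omega>) x - lie_deriv_covec G (lie_deriv_covec (\<phi> k) \<omega>) x
    + \<mu> k x *\<^sub>R lie_deriv_covec G \<omega> x + (\<omega> x \<bullet> G x) *\<^sub>R differential (\<mu> k) x"
proof -
  have "lie_deriv_covec (\<phi> (Suc k)) \<omega> x =
      lie_deriv_covec (\<lambda>y. lie_bracket (\<phi> k) G y + \<mu> k y *\<^sub>R G y) \<omega> x"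
    by (rule lie_deriv_covec_cong[OF M x phi_Suc_eq refl])
  then show ?thesis
    by (simp only: lie_deriv_covec_add_scaleR_field[OF M smooth_lie_bracket[OF M smooth_phi smooth_G]
          smooth_G smooth_mu \<omega> x]
        lie_deriv_covec_lie_bracket[OF M smooth_phi smooth_G \<omega> x])
qed

text \<open>Since \<open>lie_deriv G h\<close> is constantly 1 on \<open>M\<close>, its derivative
  along \<open>\<phi> k\<close> vanishes and \<open>\<mu> k\<close> appears with coefficient 1, so
  the formula can be solved for it.\<close>

lemma mu_eq:
  assumes x: "x \<in> M"
  shows "\<mu> k x = lie_deriv (\<phi> (Suc k)) h x + lie_deriv G (lie_deriv (\<phi> k) h) x"
proof -
  have "lie_deriv (\<phi> k) (lie_deriv G h) x = lie_deriv (\<phi> k) (\<lambda>_. 1) x"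
    by (rule lie_deriv_cong[OF M x refl lie_deriv_G_h])
  then show ?thesis
    using lie_deriv_phi_Suc[OF h x, of k] lie_deriv_G_h[OF x]
    by (simp add: lie_deriv_eq[of _ "\<lambda>_. 1"])
qed

text \<open>With \<open>L\<close> as test function, every term acquires a factor \<open>L\<close>,
  which cancels. Of the three products of \<open>\<mu> k\<close> and \<open>tau g h\<close>, the two
  coming from the iterated derivatives cancel each other.\<close>

lemma mu_Suc:
  assumes x: "x \<in> M"
  shows "\<mu> (Suc k) x = lie_deriv (\<phi> k) (tau g h) x - lie_deriv G (\<mu> k) x + \<mu> k x * tau g h x"
proof -
  have \<mu>: "lie_deriv (\<phi> j) L y = L y * \<mu> j y" if "y \<in> M" for j y
    using L_nonzero that by (simp add: \<mu>_def)
  have "lie_deriv (\<phi> k) (lie_deriv G L) x = lie_deriv (\<phi> k) (\<lambda>y. L y * tau g h y) x"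
    by (rule lie_deriv_cong[OF M x refl lie_deriv_G_L])
  also have "\<dots> = L x * lie_deriv (\<phi> k) (tau g h) x + L x * \<mu> k x * tau g h x"
    using lie_deriv_mult[OF smooth_L smooth_tau x] \<mu>[OF x] by simp
  finally have 1: "lie_deriv (\<phi> k) (lie_deriv G L) x = \<dots>" .
  have "lie_deriv G (lie_deriv (\<phi> k) L) x = lie_deriv G (\<lambda>y. L y * \<mu> k y) x"
    by (rule lie_deriv_cong[OF M x refl \<mu>])
  also have "\<dots> = L x * lie_deriv G (\<mu> k) x + L x * tau g h x * \<mu> k x"
    using lie_deriv_mult[OF smooth_L smooth_mu x] lie_deriv_G_L[OF x] by simp
  finally have 2: "lie_deriv G (lie_deriv (\<phi> k) L) x = \<dots>" .
  have "L x * \<mu> (Suc k) x =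
      L x * (lie_deriv (\<phi> k) (tau g h) x - lie_deriv G (\<mu> k) x + \<mu> k x * tau g h x)"
    using lie_deriv_phi_Suc[OF smooth_L x, of k]
    unfolding 1 2 \<mu>[OF x] lie_deriv_G_L[OF x] by (simp add: algebra_simps)
  then show ?thesis
    using L_nonzero x by simp
qed

section \<open>The increasing chain of codistributions\<close>

abbreviation \<Omega> where "\<Omega> \<equiv> Omega M f g h"

lemma Omega_span: "\<exists>S. \<Omega> k = codist_span M S"
  by (cases k) auto

text \<open>The commutator formula \<open>lie_deriv_covec_phi_Suc\<close> is stated for smooth
  covector fields, so applying it to members of \<open>\<Omega> k\<close> requires their
  smoothness.\<close>

lemma smooth_Omega: "\<omega> \<in> \<Omega> k \<Longrightarrow> smooth_on M \<omega>"
proof (induction k arbitrary: \<omega>)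
  case 0
  then show ?case
    using codist_span_smooth[OF M, of "{differential h}"] smooth_differential[OF M h] by auto
next
  case (Suc k)
  have lie: "smooth_on M \<eta>" if "smooth_on M \<theta>" "\<eta> \<in> lie_codist M \<theta> (\<Omega> k)" for \<theta> \<eta>
    by (rule codist_span_smooth[OF M _ that(2)[unfolded lie_codist_def]])
       (elim imageE, simp add: smooth_lie_deriv_covec M that(1) Suc.IH)
  have "smooth_on M \<eta>" if "\<eta> \<in> codist_span M {lie_deriv_covec (\<phi> k) (differential h)}" for \<eta>
    using that
    by (rule codist_span_smooth[OF M, rotated]) (auto intro!: smooth_intros M smooth_phi h)
  then show ?case
    using Suc.prems Suc.IH lie[OF f] lie[OF smooth_G]
    by (intro codist_span_smooth[OF M, of _ \<omega>]) auto
qed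

lemma Omega_Suc_subset: "\<Omega> k \<subseteq> \<Omega> (Suc k)"
  by (auto intro: codist_span_base)

text \<open>The generator built from \<open>\<phi> j\<close> enters at index \<open>Suc j\<close>,
  hence the strict inequality; on \<open>M\<close> it coincides with the differential.\<close>

lemma differential_lie_deriv_phi_mem:
  assumes "j < k"
  shows "differential (lie_deriv (\<phi> j) h) \<in> \<Omega> k"
proof -
  have "lie_deriv_covec (\<phi> j) (differential h) \<in> \<Omega> (Suc j)"
    by (auto intro!: codist_span_base)
  moreover obtain S where "\<Omega> (Suc j) = codist_span M S"
    using Omega_span by blast
  ultimately have "differential (lie_deriv (\<phi> j) h) \<in> \<Omega> (Suc j)"
    using codist_span_cong lie_deriv_covec_differential[OF M smooth_phi h] by metis
  moreover have "\<Omega> (Suc j) \<subseteq> \<Omega> k"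
    by (rule lift_Suc_mono_le[of \<Omega>, OF Omega_Suc_subset Suc_leI[OF assms]])
  ultimately show ?thesis by blast
qed

section \<open>Invariance and stationarity of the chain\<close>

context
  fixes m
  assumes m: "m \<ge> 2"
    and tau: "differential (tau g h) \<in> \<Omega> m"
    and inv_f: "codist_invariant M f (\<Omega> m)"
    and inv_G: "codist_invariant M G (\<Omega> m)"
begin

text \<open>Being a span, \<open>\<Omega> m\<close> is a module over the smooth functions and
  ignores values outside \<open>M\<close>; this is the form in which the induction below uses
  it.\<close>

lemma
  shows Omega_cong: "\<omega> \<in> \<Omega> m \<Longrightarrow> (\<And>x. x \<in> M \<Longrightarrow> \<omega>' x = \<omega> x) \<Longrightarrow> \<omega>' \<in> \<Omega> m"
    and Omega_add: "\<omega> \<in> \<Omega> m \<Longrightarrow> \<omega>' \<in> \<Omega> m \<Longrightarrow> (\<lambda>x. \<omega> x + \<omega>' x) \<in> \<Omega> m"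
    and Omega_diff: "\<omega> \<in> \<Omega> m \<Longrightarrow> \<omega>' \<in> \<Omega> m \<Longrightarrow> (\<lambda>x. \<omega> x - \<omega>' x) \<in> \<Omega> m"
    and Omega_scale: "smooth_on M a \<Longrightarrow> \<omega> \<in> \<Omega> m \<Longrightarrow> (\<lambda>x. a x *\<^sub>R \<omega> x) \<in> \<Omega> m"
    and Omega_span_subset: "S \<subseteq> \<Omega> m \<Longrightarrow> codist_span M S \<subseteq> \<Omega> m"
proof -
  obtain S where S: "\<Omega> m = codist_span M S" using Omega_span by blast
  show "\<omega> \<in> \<Omega> m \<Longrightarrow> (\<And>x. x \<in> M \<Longrightarrow> \<omega>' x = \<omega> x) \<Longrightarrow> \<omega>' \<in> \<Omega> m"
    unfolding S by (rule codist_span_cong)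
  show "\<omega> \<in> \<Omega> m \<Longrightarrow> \<omega>' \<in> \<Omega> m \<Longrightarrow> (\<lambda>x. \<omega> x + \<omega>' x) \<in> \<Omega> m"
    unfolding S by (rule codist_span_add[OF M])
  show "\<omega> \<in> \<Omega> m \<Longrightarrow> \<omega>' \<in> \<Omega> m \<Longrightarrow> (\<lambda>x. \<omega> x - \<omega>' x) \<in> \<Omega> m"
    unfolding S by (rule codist_span_diff[OF M])
  show "smooth_on M a \<Longrightarrow> \<omega> \<in> \<Omega> m \<Longrightarrow> (\<lambda>x. a x *\<^sub>R \<omega> x) \<in> \<Omega> m"
    unfolding S by (rule codist_span_scale[OF M])
  show "codist_span M S' \<subseteq> \<Omega> m" if "S' \<subseteq> \<Omega> m" for S'
    using that unfolding S by (rule codist_span_minimal[OF M])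
qed

lemma differential_lie_deriv_mem:
  assumes "smooth_on M \<theta>" "smooth_on M F" "lie_deriv_covec \<theta> (differential F) \<in> \<Omega> m"
  shows "differential (lie_deriv \<theta> F) \<in> \<Omega> m"
  using assms(3) by (rule Omega_cong) (simp add: lie_deriv_covec_differential[OF M assms(1,2)])

lemma phi_invariant:
  "(\<forall>\<omega>\<in>\<Omega> m. lie_deriv_covec (\<phi> k) \<omega> \<in> \<Omega> m) \<and>
   differential (lie_deriv (\<phi> k) h) \<in> \<Omega> m \<and> differential (lie_deriv (\<phi> (Suc k)) h) \<in> \<Omega> m"
proof (induction k)
  case 0
  then show ?case
    \<comment> \<open>The differential belonging to \<open>\<phi> 1\<close> lies in
      \<open>\<Omega> m\<close> because \<open>1 < m\<close>.\<close>
    using m differential_lie_deriv_phi_mem[of 0 m] differential_lie_deriv_phi_mem[of 1 m]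
      codist_invariantD[OF inv_f] by simp
next
  case (Suc k)
  have G: "lie_deriv_covec G \<omega> \<in> \<Omega> m" if "\<omega> \<in> \<Omega> m" for \<omega>
    using codist_invariantD[OF inv_G that] .
  have \<phi>: "lie_deriv_covec (\<phi> k) \<omega> \<in> \<Omega> m" if "\<omega> \<in> \<Omega> m" for \<omega>
    using Suc.IH that by blast
  have smooth: "smooth_on M (lie_deriv (\<phi> j) h)" for j
    by (intro smooth_intros M smooth_phi h)
  \<comment> \<open>Both directions serve: from right to left at \<open>k\<close> to obtain
    \<open>differential (\<mu> k)\<close>, from left to right at \<open>Suc k\<close> to obtain the
    new differential of the induction step.\<close>
  have \<mu>: "differential (\<mu> j) \<in> \<Omega> m \<longleftrightarrow> differential (lie_deriv (\<phi> (Suc j)) h) \<in> \<Omega> m"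
    if "differential (lie_deriv (\<phi> j) h) \<in> \<Omega> m" for j
  proof -
    have LG: "differential (lie_deriv G (lie_deriv (\<phi> j) h)) \<in> \<Omega> m"
      by (intro differential_lie_deriv_mem smooth_G smooth G that)
    have eq: "differential (\<mu> j) x = differential (lie_deriv (\<phi> (Suc j)) h) x
        + differential (lie_deriv G (lie_deriv (\<phi> j) h)) x" if x: "x \<in> M" for x
    proof -
      have "differential (\<mu> j) x =
          differential (\<lambda>y. lie_deriv (\<phi> (Suc j)) h y + lie_deriv G (lie_deriv (\<phi> j) h) y) x"
        by (rule differential_cong[OF M x mu_eq])
      then show ?thesis
        by (simp only: differential_add[OF smooth smooth_lie_deriv[OF M smooth_G smooth] x])
    qed
    show ?thesis
    proof
      assume "differential (\<mu> j) \<in> \<Omega> m"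
      from Omega_diff[OF this LG] show "differential (lie_deriv (\<phi> (Suc j)) h) \<in> \<Omega> m"
        by (rule Omega_cong) (simp add: eq del: phi.simps)
    next
      assume "differential (lie_deriv (\<phi> (Suc j)) h) \<in> \<Omega> m"
      from Omega_add[OF this LG] show "differential (\<mu> j) \<in> \<Omega> m"
        by (rule Omega_cong) (simp add: eq del: phi.simps)
    qed
  qed
  have \<mu>k: "differential (\<mu> k) \<in> \<Omega> m"
    using \<mu> Suc.IH by blast
  have "lie_deriv_covec (\<phi> (Suc k)) \<omega> \<in> \<Omega> m" if \<omega>: "\<omega> \<in> \<Omega> m" for \<omega>
  proof (rule Omega_cong)
    \<comment> \<open>Each summand is in \<open>\<Omega> m\<close> by invariance along
      \<open>\<phi> k\<close> and \<open>G\<close> or by membership of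
      \<open>differential (\<mu> k)\<close>; the scalars \<open>\<mu> k\<close> and
      \<open>\<omega> x \<bullet> G x\<close> are smooth.\<close>
    show "(\<lambda>x. lie_deriv_covec (\<phi> k) (lie_deriv_covec G \<omega>) x
        - lie_deriv_covec G (lie_deriv_covec (\<phi> k) \<omega>) x
        + \<mu> k x *\<^sub>R lie_deriv_covec G \<omega> x + (\<omega> x \<bullet> G x) *\<^sub>R differential (\<mu> k) x) \<in> \<Omega> m"
      by (intro Omega_add Omega_diff Omega_scale G \<phi> \<omega> \<mu>k smooth_mu smooth_inner M smooth_G
          smooth_Omega[OF \<omega>])
  qed (rule lie_deriv_covec_phi_Suc[OF smooth_Omega[OF \<omega>]])
  moreover have "differential (\<mu> (Suc k)) \<in> \<Omega> m"
  proof (rule Omega_cong)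
    \<comment> \<open>Here the assumption on \<open>tau\<close> enters: its differential is carried
      along \<open>\<phi> k\<close> by the invariance from the induction hypothesis.\<close>
    have "differential (lie_deriv (\<phi> k) (tau g h)) \<in> \<Omega> m"
      by (intro differential_lie_deriv_mem smooth_phi smooth_tau \<phi> tau)
    moreover have "differential (lie_deriv G (\<mu> k)) \<in> \<Omega> m"
      by (intro differential_lie_deriv_mem smooth_G smooth_mu G \<mu>k)
    ultimately show "(\<lambda>x. differential (lie_deriv (\<phi> k) (tau g h)) x - differential (lie_deriv G (\<mu> k)) x
        + (\<mu> k x *\<^sub>R differential (tau g h) x + tau g h x *\<^sub>R differential (\<mu> k) x)) \<in> \<Omega> m"
      by (intro Omega_add Omega_diff Omega_scale tau \<mu>k smooth_mu smooth_tau)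
  next
    fix x assume x: "x \<in> M"
    have s: "smooth_on M (lie_deriv (\<phi> k) (tau g h))" "smooth_on M (lie_deriv G (\<mu> k))"
      by (intro smooth_intros M smooth_phi smooth_tau smooth_G smooth_mu)+
    have "differential (\<mu> (Suc k)) x = differential
        (\<lambda>y. lie_deriv (\<phi> k) (tau g h) y - lie_deriv G (\<mu> k) y + \<mu> k y * tau g h y) x"
      by (rule differential_cong[OF M x mu_Suc])
    then show "differential (\<mu> (Suc k)) x =
        differential (lie_deriv (\<phi> k) (tau g h)) x - differential (lie_deriv G (\<mu> k)) x
        + (\<mu> k x *\<^sub>R differential (tau g h) x + tau g h x *\<^sub>R differential (\<mu> k) x)"
      by (simp only: differential_add[OF smooth_diff[OF M s] smooth_mult[OF M smooth_mu smooth_tau] x]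
          differential_diff[OF s x] differential_mult[OF smooth_mu smooth_tau x])
  qed
  ultimately show ?case
    using \<mu>[of "Suc k"] Suc.IH by blast
qed

text \<open>If the chain has stayed at \<open>\<Omega> m\<close> so far, the next step adds Lie
  derivatives along \<open>f\<close> and \<open>G\<close>, absorbed by the assumed invariance, and
  one generator along \<open>\<phi> (m + p)\<close>, absorbed because \<open>phi_invariant\<close>
  holds for every index.\<close>

lemma Omega_stationary: "\<Omega> (m + p) = \<Omega> m"
proof (induction p)
  case (Suc p)
  have "differential h \<in> \<Omega> 0"
    by (simp add: codist_span_base)
  then have "differential h \<in> \<Omega> m"
    using lift_Suc_mono_le[of \<Omega> 0 m, OF Omega_Suc_subset] by blast
  then have "codist_span M {lie_deriv_covec (\<phi> (m + p)) (differential h)} \<subseteq> \<Omega> m"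
    using phi_invariant by (intro Omega_span_subset) blast
  then have "\<Omega> (Suc (m + p)) \<subseteq> \<Omega> m"
    using inv_f inv_G unfolding Omega.simps Suc.IH codist_invariant_def
    by (intro Omega_span_subset[of "_ \<union> _"] Un_least order_refl)
  then show ?case
    using Omega_Suc_subset[of "m + p"] Suc.IH by auto
qed simp

end

end

theorem theorem2:
  fixes M :: "(real ^ 'n) set"
    and f g :: "real ^ 'n \<Rightarrow> real ^ 'n"
    and h :: "real ^ 'n \<Rightarrow> real"
    and m :: nat
  assumes "open M"
    and "smooth_on M f" and "smooth_on M g" and "smooth_on M h"
    and "\<forall>x\<in>M. lie_deriv g h x \<noteq> 0"
    and "m \<ge> 2"
    and "differential (tau g h) \<in> Omega M f g h m"
    and "codist_invariant M f (Omega M f g h m)"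
    and "codist_invariant M (g_normalized g h) (Omega M f g h m)"
  shows "\<forall>p. Omega M f g h (m + p) = Omega M f g h m"
proof -
  interpret lie_system M f g h
    by unfold_locales (fact assms)+
  show ?thesis
    using Omega_stationary[OF assms(6-9)] by blast
qed

end
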